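(* Fix any graph $G$. Let $T_k$ be the worst-case expected extinction time for two-type annihilation on $G$ starting from $k$ particles of each type, maximised over any speeds and starting positions (which may coincide). Then $$k\,H_{\max}(G)\le T_k<4k\,H_{\max}(G).$$
   Context: For vertices $x,y$ of $G$, the hitting time $H_x(y)$ is the expected number of steps taken by a random walk on $G$ started at $x$ and stopped when it first hits $y$, and $H_{\max}(G)=\max_{x,y\in V(G)}H_x(y)$ is the worst-case hitting time. Two-type annihilation: there are initially $k$ red and $k$ blue particles on vertices of $G$; multiple particles at the same vertex are permitted. The speeds are given by a parameter $p\in[0,1]$ (speed $p$ for red and $1-p$ for blue). At each time step, with probability $p$ a red particle is chosen, uniformly at random from the remaining red particles, and otherwise a uniformly random remaining blue particle is chosen. The chosen particle performs a simple random walk step. If it reaches a vertex with one or more particles of the opposite colour, it mutually annihilates with one such particle (both are removed). The extinction time is the number of steps taken until no particles remain. *)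

theory Defs
  imports "HOL-Probability.Probability" "Graph_Theory.Digraph_Component"
begin

section \<open>Path measure of a discrete-time Markov chain\<close>

text \<open>Given a transition kernel \<open>K\<close> and an initial state \<open>s\<close>, \<open>markov_law K s i \<omega>\<close> is the conditional
  law of the state at time \<open>i\<close> given the history \<open>\<omega>\<close> up to time \<open>i - 1\<close>. The measure
  \<open>markov_paths K s\<close> on infinite trajectories is the one given by the Ionescu-Tulcea theorem; its
  finite-dimensional distributions are spelled out in \<open>emeasure_markov_paths\<close>.\<close>

definition markov_law :: "('s \<Rightarrow> 's pmf) \<Rightarrow> 's \<Rightarrow> nat \<Rightarrow> (nat \<Rightarrow> 's) \<Rightarrow> 's measure" where
  "markov_law K s i \<omega> = measure_pmf (case i of 0 \<Rightarrow> return_pmf s | Suc j \<Rightarrow> K (\<omega> j))"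

definition markov_paths :: "('s \<Rightarrow> 's pmf) \<Rightarrow> 's \<Rightarrow> (nat \<Rightarrow> 's) measure" where
  "markov_paths K s =
     projective_family.lim UNIV (Ionescu_Tulcea.CI (markov_law K s) (\<lambda>_. count_space UNIV))
       (\<lambda>_. count_space UNIV)"

lemma Ionescu_Tulcea_markov_law: "Ionescu_Tulcea (markov_law K s) (\<lambda>_. count_space UNIV)"
proof (rule Ionescu_Tulcea.intro)
  fix i
  show "markov_law K s i \<in> measurable (PiM {0..<i} (\<lambda>_. count_space UNIV))
          (subprob_algebra (count_space UNIV))"
  proof (cases i)
    case 0
    then show ?thesis
      by (simp add: markov_law_def[abs_def] measurable_const measure_pmf_in_subprob_algebra)
  next
    case (Suc j)
    have "(\<lambda>\<omega>. \<omega> j) \<in> measurable (PiM {0..<i} (\<lambda>_. count_space UNIV)) (count_space UNIV)"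
      by (rule measurable_component_singleton) (simp add: Suc)
    then have "(\<lambda>\<omega>. measure_pmf (K (\<omega> j))) \<in> measurable (PiM {0..<i} (\<lambda>_. count_space UNIV))
          (subprob_algebra (count_space UNIV))"
      by (rule measurable_compose) (simp add: measure_pmf_in_subprob_algebra)
    then show ?thesis
      by (simp add: markov_law_def[abs_def] Suc)
  qed
qed (simp add: markov_law_def measure_pmf.prob_space_axioms)

lemma emeasure_markov_paths:
  "emeasure (markov_paths K s) {\<omega>. \<forall>i\<le>n. \<omega> i = x i} =
     (if x 0 = s then \<Prod>i<n. ennreal (pmf (K (x i)) (x (Suc i))) else 0)"
proof -
  let ?M = "\<lambda>_::nat. count_space (UNIV::'a set)"
  interpret IT: Ionescu_Tulcea "markov_law K s" ?M
    by (rule Ionescu_Tulcea_markov_law)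
  define X where "X m = (\<Pi>\<^sub>E i\<in>{0..<m}. {x i})" for m
  have X_sets: "X m \<in> sets (PiM {0..<m} ?M)" for m
    unfolding X_def by (intro sets_PiM_I_finite) auto
  have undef: "(\<lambda>_. undefined) \<in> space (PiM {0..<0} ?M)"
    by (simp add: space_PiM)
  have X_single: "X m = {restrict x {0..<m}}" for m
    by (auto simp: X_def PiE_def extensional_def Pi_def restrict_def fun_eq_iff)
  have C_Suc: "emeasure (IT.C 0 (Suc m) (\<lambda>_. undefined)) (X (Suc m)) =
      emeasure (IT.C 0 m (\<lambda>_. undefined)) (X m) * markov_law K s m x {x m}" for m
  proof -
    have "emeasure (IT.C 0 (Suc m) (\<lambda>_. undefined)) (X (Suc m)) =
        (\<integral>\<^sup>+ \<omega>. emeasure (IT.eP m \<omega>) (X (Suc m)) \<partial>IT.C 0 m (\<lambda>_. undefined))"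
    proof -
      have "emeasure (IT.C 0 m (\<lambda>_. undefined) \<bind> IT.eP m) (X (Suc m)) =
          (\<integral>\<^sup>+ \<omega>. emeasure (IT.eP m \<omega>) (X (Suc m)) \<partial>IT.C 0 m (\<lambda>_. undefined))"
      proof (rule emeasure_bind)
        show "space (IT.C 0 m (\<lambda>_. undefined)) \<noteq> {}"
          using IT.prob_space_C[OF undef] by (rule prob_space.not_empty)
        show "IT.eP m \<in> measurable (IT.C 0 m (\<lambda>_. undefined)) (subprob_algebra (PiM {0..<Suc m} ?M))"
          using IT.measurable_eP[of m] IT.sets_C[OF undef, of m]
          by (simp cong: measurable_cong_sets)
      qed (rule X_sets)
      then show ?thesis by simp
    qed
    also have "\<dots> = (\<integral>\<^sup>+ \<omega>. indicator (X m) \<omega> * markov_law K s m x {x m} \<partial>IT.C 0 m (\<lambda>_. undefined))"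
    proof (rule nn_integral_cong)
      fix \<omega> assume "\<omega> \<in> space (IT.C 0 m (\<lambda>_. undefined))"
      then have \<omega>: "\<omega> \<in> space (PiM {0..<m} ?M)"
        using IT.space_C[OF undef, of m] by simp
      then have ext: "\<omega> \<in> extensional {0..<m}" by (simp add: space_PiM PiE_def)
      have "emeasure (IT.eP m \<omega>) (X (Suc m)) =
          markov_law K s m \<omega> (fun_upd \<omega> m -` X (Suc m) \<inter> UNIV)"
        using IT.emeasure_eP[OF \<omega> X_sets[of "Suc m"]] by simp
      also have "fun_upd \<omega> m -` X (Suc m) \<inter> UNIV = (if \<omega> \<in> X m then {x m} else {})"
        using ext by (auto simp: X_def PiE_iff extensional_def split: if_splits)
      also have "markov_law K s m \<omega> (if \<omega> \<in> X m then {x m} else {}) =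
          indicator (X m) \<omega> * markov_law K s m x {x m}"
        by (auto simp: X_single markov_law_def split: nat.split)
      finally show "emeasure (IT.eP m \<omega>) (X (Suc m)) =
          indicator (X m) \<omega> * markov_law K s m x {x m}" .
    qed
    also have "\<dots> = emeasure (IT.C 0 m (\<lambda>_. undefined)) (X m) * markov_law K s m x {x m}"
    proof -
      have "X m \<in> sets (IT.C 0 m (\<lambda>_. undefined))"
        using X_sets[of m] IT.sets_C[OF undef, of m] by simp
      then show ?thesis
        by (subst nn_integral_multc) simp_all
    qed
    finally show ?thesis .
  qed
  have C: "emeasure (IT.C 0 (Suc m) (\<lambda>_. undefined)) (X (Suc m)) =
      (if x 0 = s then \<Prod>i<m. ennreal (pmf (K (x i)) (x (Suc i))) else 0)" for m
  proof (induction m)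
    case 0
    have "emeasure (IT.C 0 0 (\<lambda>_. undefined)) (X 0) = 1"
      unfolding IT.C.simps(1) emeasure_return[OF X_sets] by (simp add: X_def)
    then show ?case
      by (subst C_Suc) (simp add: markov_law_def emeasure_pmf_single)
  next
    case (Suc m)
    show ?case
      by (subst C_Suc, subst Suc) (simp add: markov_law_def emeasure_pmf_single)
  qed
  have "{\<omega>. \<forall>i\<le>n. \<omega> i = x i} = prod_emb UNIV ?M {0..<Suc n} (X (Suc n))"
    by (auto simp: prod_emb_def X_def PiE_iff less_Suc_eq_le)
  then have "emeasure (markov_paths K s) {\<omega>. \<forall>i\<le>n. \<omega> i = x i} =
      emeasure (IT.CI {0..<Suc n}) (X (Suc n))"
    unfolding markov_paths_def using IT.lim[OF _ X_sets[of "Suc n"]] by simp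
  also have "\<dots> = emeasure (IT.C 0 (Suc n) (\<lambda>_. undefined)) (prod_emb {0..<Suc n} ?M {0..<Suc n} (X (Suc n)))"
    by (rule IT.emeasure_CI) (use X_sets[of "Suc n"] in auto)
  also have "prod_emb {0..<Suc n} ?M {0..<Suc n} (X (Suc n)) = X (Suc n)"
    by (rule prod_emb_id) (use X_sets[of "Suc n"] in \<open>auto simp: X_def\<close>)
  finally show ?thesis unfolding C .
qed

text \<open>First time at which the trajectory lies in \<open>A\<close>; it is \<open>\<infinity>\<close> if this never happens.\<close>

definition first_time :: "'s set \<Rightarrow> (nat \<Rightarrow> 's) \<Rightarrow> ennreal" where
  "first_time A \<omega> = (INF n\<in>{n. \<omega> n \<in> A}. of_nat n)"

section \<open>Hitting times of the simple random walk\<close>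

definition srw_step :: "('a, 'b) pre_digraph \<Rightarrow> 'a \<Rightarrow> 'a pmf" where
  "srw_step G v = pmf_of_set {w. v \<rightarrow>\<^bsub>G\<^esub> w}"

definition hitting_time :: "('a, 'b) pre_digraph \<Rightarrow> 'a \<Rightarrow> 'a \<Rightarrow> ennreal" where
  "hitting_time G x y = (\<integral>\<^sup>+ \<omega>. first_time {y} \<omega> \<partial>markov_paths (srw_step G) x)"

definition max_hitting_time :: "('a, 'b) pre_digraph \<Rightarrow> ennreal" where
  "max_hitting_time G = (SUP x\<in>verts G. SUP y\<in>verts G. hitting_time G x y)"

section \<open>Two-type annihilation\<close>

text \<open>A state \<open>(R, B)\<close> consists of the multisets of positions of the remaining red and blue
  particles. In \<open>move_particle G A C\<close> a uniformly random particle of the colour with positions \<open>A\<close>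
  moves. Annihilation is only triggered by a move, so particles of opposite colours placed on the
  same vertex at time \<open>0\<close> coexist there until one of them leaves or a further particle arrives.\<close>

definition move_particle ::
  "('a, 'b) pre_digraph \<Rightarrow> 'a multiset \<Rightarrow> 'a multiset \<Rightarrow> ('a multiset \<times> 'a multiset) pmf" where
  "move_particle G A C =
     do {
       x \<leftarrow> pmf_of_multiset A;
       y \<leftarrow> srw_step G x;
       return_pmf (if y \<in># C then (A - {#x#}, C - {#y#}) else (add_mset y (A - {#x#}), C))
     }"

text \<open>Both colours always have equally many particles, so every state other than the (absorbing)
  extinct one offers a particle of each colour to choose from.\<close>

definition annihilation_step ::
  "('a, 'b) pre_digraph \<Rightarrow> real \<Rightarrow> 'a multiset \<times> 'a multiset \<Rightarrow> ('a multiset \<times> 'a multiset) pmf"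
where
  "annihilation_step G p = (\<lambda>(R, B).
     if R = {#} \<and> B = {#} then return_pmf ({#}, {#})
     else do {
       red \<leftarrow> bernoulli_pmf p;
       if red then move_particle G R B else map_pmf prod.swap (move_particle G B R)
     })"

definition expected_extinction_time ::
  "('a, 'b) pre_digraph \<Rightarrow> real \<Rightarrow> 'a multiset \<Rightarrow> 'a multiset \<Rightarrow> ennreal" where
  "expected_extinction_time G p R B =
     (\<integral>\<^sup>+ \<omega>. first_time {({#}, {#})} \<omega> \<partial>markov_paths (annihilation_step G p) (R, B))"

definition worst_extinction_time :: "('a, 'b) pre_digraph \<Rightarrow> nat \<Rightarrow> ennreal" where
  "worst_extinction_time G k =
     (SUP (p, R, B)\<in>{(p, R, B). 0 \<le> p \<and> p \<le> 1 \<and> size R = k \<and> size B = k \<and>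
          set_mset R \<subseteq> verts G \<and> set_mset B \<subseteq> verts G}.
        expected_extinction_time G p R B)"

end

theory Submission
  imports Defs
begin

text \<open>Upper bound. Write \<open>H x y\<close> for the hitting time of \<open>y\<close> from \<open>x\<close>, and \<open>h\<close> for its maximum. By reversibility
  there is a function \<open>c \<ge> 0\<close> such that \<open>H x y + c y\<close> is symmetric in \<open>x\<close> and \<open>y\<close>; it satisfies the triangle
  inequality, is at most \<open>2 h - 1\<close>, and drops by one on average whenever either of two distinct
  points makes a random walk step. Match red with blue particles and charge each pair this potential
  plus \<open>2 h - 2\<close>, or \<open>4 h - 2\<close> if the two coincide. The cost of the cheapest matching then drops by at
  least one on average in every step, whichever colour moves, since after an annihilation the two
  bereaved partners can be matched by the triangle inequality. Hence the extinction time is at most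
  \<open>k (4 h - 2)\<close>.

  Lower bound. If only red moves, all blue particles sit at \<open>y\<close> and all red ones start at \<open>x\<close>, the expected
  extinction time is \<open>k H x y\<close>.\<close>

section \<open>Expected first times of Markov chains\<close>

text \<open>Killing is tested at the state being left, so the \<open>n\<close>-th iterate on
  \<open>indicator (- A)\<close> is the probability of avoiding \<open>A\<close> at all times up to
  and including \<open>n\<close>.\<close>

definition killed_step :: "('s \<Rightarrow> 's pmf) \<Rightarrow> 's set \<Rightarrow> ('s \<Rightarrow> ennreal) \<Rightarrow> 's \<Rightarrow> ennreal" where
  "killed_step K A g s = indicator (- A) s * (\<integral>\<^sup>+ t. g t \<partial>K s)"

text \<open>Induct on \<open>n\<close> for all \<open>g\<close> at once: integrating out the last
  coordinate turns \<open>g\<close> into \<open>killed_step K A g\<close>. Path integrals are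
  thereby replaced by iterates of an operator.\<close>

lemma nn_integral_markov_paths_prefix:
  fixes g :: "'s \<Rightarrow> ennreal"
  shows "(\<integral>\<^sup>+ \<omega>. (\<Prod>i<n. indicator (- A) (\<omega> i)) * g (\<omega> n) \<partial>markov_paths K s) = (killed_step K A ^^ n) g s"
proof -
  let ?M = "\<lambda>_::nat. count_space (UNIV::'s set)"
  interpret IT: Ionescu_Tulcea "markov_law K s" ?M
    by (rule Ionescu_Tulcea_markov_law)
  let ?u = "\<lambda>_::nat. undefined :: 's"
  have undef: "?u \<in> space (PiM {0..<0} ?M)"
    by (simp add: space_PiM)
  have meas_comp: "(\<lambda>\<omega>. f (\<omega> i)) \<in> borel_measurable (PiM {0..<m} ?M)" if "i < m"
    for f :: "'s \<Rightarrow> ennreal" and i m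
    using that by (intro measurable_compose[OF measurable_component_singleton]) auto
  have meas: "(\<lambda>\<omega>. (\<Prod>i<n. indicator (- A) (\<omega> i)) * g (\<omega> n)) \<in> borel_measurable (PiM {0..<Suc n} ?M)"
    for n and g :: "'s \<Rightarrow> ennreal"
    by (intro borel_measurable_times_ennreal borel_measurable_prod_ennreal meas_comp) auto
  have eP: "(\<integral>\<^sup>+ \<omega>'. f \<omega>' \<partial>IT.eP m \<omega>) = (\<integral>\<^sup>+ t. f (fun_upd \<omega> m t) \<partial>markov_law K s m \<omega>)"
    if "\<omega> \<in> space (PiM {0..<m} ?M)" "f \<in> borel_measurable (PiM {0..<Suc m} ?M)" for f m \<omega>
    using IT.nn_integral_eP[OF that] .
  have bind: "(\<integral>\<^sup>+ \<omega>. f \<omega> \<partial>IT.C 0 (Suc m) ?u) = (\<integral>\<^sup>+ \<omega>. \<integral>\<^sup>+ t. f (fun_upd \<omega> m t) \<partial>markov_law K s m \<omega> \<partial>IT.C 0 m ?u)"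
    if f: "f \<in> borel_measurable (PiM {0..<Suc m} ?M)" for f m
  proof -
    have "(\<integral>\<^sup>+ \<omega>. f \<omega> \<partial>IT.C 0 (Suc m) ?u) = (\<integral>\<^sup>+ \<omega>. \<integral>\<^sup>+ \<omega>'. f \<omega>' \<partial>IT.eP m \<omega> \<partial>IT.C 0 m ?u)"
      unfolding IT.C.simps(2) add_0
    proof (rule nn_integral_bind[OF f])
      show "IT.eP m \<in> measurable (IT.C 0 m ?u) (subprob_algebra (PiM {0..<Suc m} ?M))"
        using IT.measurable_eP[of m] IT.sets_C[OF undef, of m] by (simp cong: measurable_cong_sets)
    qed
    also have "\<dots> = (\<integral>\<^sup>+ \<omega>. \<integral>\<^sup>+ t. f (fun_upd \<omega> m t) \<partial>markov_law K s m \<omega> \<partial>IT.C 0 m ?u)"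
      by (intro nn_integral_cong eP f) (use IT.space_C[OF undef, of m] in simp)
    finally show ?thesis .
  qed
  have C: "(\<integral>\<^sup>+ \<omega>. (\<Prod>i<n. indicator (- A) (\<omega> i)) * g (\<omega> n) \<partial>IT.C 0 (Suc n) ?u) = (killed_step K A ^^ n) g s"
    for n and g :: "'s \<Rightarrow> ennreal"
  proof (induction n arbitrary: g)
    case 0
    show ?case
      unfolding bind[OF meas] IT.C.simps(1)
      by (subst nn_integral_return) (auto simp: markov_law_def space_PiM)
  next
    case (Suc n)
    have "(\<integral>\<^sup>+ \<omega>. (\<Prod>i<Suc n. indicator (- A) (\<omega> i)) * g (\<omega> (Suc n)) \<partial>IT.C 0 (Suc (Suc n)) ?u)
      = (\<integral>\<^sup>+ \<omega>. (\<Prod>i<n. indicator (- A) (\<omega> i)) * killed_step K A g (\<omega> n) \<partial>IT.C 0 (Suc n) ?u)"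
      unfolding bind[OF meas[of "Suc n" g]]
      by (intro nn_integral_cong)
        (simp add: markov_law_def killed_step_def nn_integral_cmult mult.assoc)
    also have "\<dots> = (killed_step K A ^^ n) (killed_step K A g) s"
      by (rule Suc.IH)
    also have "\<dots> = (killed_step K A ^^ Suc n) g s"
      by (simp only: funpow_Suc_right comp_def)
    finally show ?case .
  qed
  \<comment> \<open>On an initial segment of times there is nothing to project away, so the
    finite-dimensional marginal is the composed kernel itself.\<close>
  have CI: "IT.CI {0..<Suc n} = IT.C 0 (Suc n) ?u"
  proof (rule measure_eqI)
    show "sets (IT.CI {0..<Suc n}) = sets (IT.C 0 (Suc n) ?u)"
      using IT.sets_C[OF undef, of "Suc n"] by (simp add: IT.CI_def del: IT.C.simps)
    fix X assume "X \<in> sets (IT.CI {0..<Suc n})"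
    then have X: "X \<in> sets (PiM {0..<Suc n} ?M)"
      by (simp add: IT.CI_def)
    show "emeasure (IT.CI {0..<Suc n}) X = emeasure (IT.C 0 (Suc n) ?u) X"
      using IT.emeasure_CI[OF subset_refl X] sets.sets_into_space[OF X]
      by (simp add: prod_emb_id space_PiM del: IT.C.simps)
  qed
  have "(\<integral>\<^sup>+ \<omega>. (\<Prod>i<n. indicator (- A) (\<omega> i)) * g (\<omega> n) \<partial>markov_paths K s)
      = (\<integral>\<^sup>+ \<omega>. (\<Prod>i<n. indicator (- A) (restrict \<omega> {0..<Suc n} i)) * g (restrict \<omega> {0..<Suc n} n) \<partial>IT.PF.lim)"
    unfolding markov_paths_def by simp
  also have "\<dots> = (\<integral>\<^sup>+ \<omega>. (\<Prod>i<n. indicator (- A) (\<omega> i)) * g (\<omega> n)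
      \<partial>distr IT.PF.lim (PiM {0..<Suc n} ?M) (\<lambda>\<omega>. restrict \<omega> {0..<Suc n}))"
    by (subst nn_integral_distr)
      (auto intro!: meas measurable_restrict simp: measurable_cong_sets[OF IT.PF.sets_lim refl])
  also have "\<dots> = (killed_step K A ^^ n) g s"
    unfolding IT.distr_lim[OF finite_atLeastLessThan] CI by (rule C)
  finally show ?thesis .
qed

text \<open>The \<open>n\<close>-th summand is 1 exactly when the first time exceeds
  \<open>n\<close>. Splitting off the last factor gives each summand the shape handled by
  \<open>nn_integral_markov_paths_prefix\<close>.\<close>

lemma first_time_eq_suminf:
  "first_time A \<omega> = (\<Sum>n. (\<Prod>i<n. indicator (- A) (\<omega> i)) * indicator (- A) (\<omega> n))"
proof -
  have ind: "(\<Prod>i<n. indicator (- A) (\<omega> i)) * indicator (- A) (\<omega> n)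
      = (if \<forall>i\<le>n. \<omega> i \<notin> A then 1 else 0 :: ennreal)" for n
    by (induction n) (auto simp: le_Suc_eq)
  show ?thesis
  proof (cases "\<exists>n. \<omega> n \<in> A")
    case True
    define m where "m = (LEAST n. \<omega> n \<in> A)"
    have m: "\<omega> m \<in> A" and m_le: "\<And>n. \<omega> n \<in> A \<Longrightarrow> m \<le> n"
      unfolding m_def using True by (auto intro: LeastI_ex Least_le)
    have "first_time A \<omega> = of_nat m"
      unfolding first_time_def using m m_le
      by (intro antisym INF_greatest INF_lower2[of m]) auto
    moreover have "(\<forall>i\<le>n. \<omega> i \<notin> A) \<longleftrightarrow> n < m" for n
      using m m_le by (meson not_le order_trans)
    then have "(\<Sum>n. (\<Prod>i<n. indicator (- A) (\<omega> i)) * indicator (- A) (\<omega> n)) = (of_nat m :: ennreal)"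
      unfolding ind by (subst suminf_finite[of "{..<m}"]) auto
    ultimately show ?thesis
      by simp
  next
    case False
    then have "first_time A \<omega> = \<infinity>"
      by (simp add: first_time_def)
    moreover have "(\<Sum>n. (\<Prod>i<n. indicator (- A) (\<omega> i)) * indicator (- A) (\<omega> n)) = (\<infinity> :: ennreal)"
    proof -
      have "(of_nat N :: ennreal) \<le> (\<Sum>n. 1)" for N
        using sum_le_suminf[of "\<lambda>_. 1::ennreal" "{..<N}"] by simp
      then have "(\<Sum>n::nat. 1 :: ennreal) = \<infinity>"
        by (metis ennreal_Ex_less_of_nat leD infinity_ennreal_def less_top)
      then show ?thesis
        unfolding ind using False by simp
    qed
    ultimately show ?thesis by simp
  qed
qed

definition expected_time :: "('s \<Rightarrow> 's pmf) \<Rightarrow> 's set \<Rightarrow> 's \<Rightarrow> ennreal" where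
  "expected_time K A s = (\<integral>\<^sup>+ \<omega>. first_time A \<omega> \<partial>markov_paths K s)"

text \<open>Integrating termwise yields the tail-sum formula for an expectation, infinite values
  included.\<close>

lemma expected_time_eq_suminf:
  "expected_time K A s = (\<Sum>n. (killed_step K A ^^ n) (indicator (- A)) s)"
proof -
  have sets: "sets (markov_paths K s) = sets (PiM UNIV (\<lambda>_. count_space UNIV))"
  proof -
    interpret IT: Ionescu_Tulcea "markov_law K s" "\<lambda>_. count_space UNIV"
      by (rule Ionescu_Tulcea_markov_law)
    show ?thesis
      unfolding markov_paths_def by simp
  qed
  have "(\<lambda>\<omega>. f (\<omega> i)) \<in> borel_measurable (markov_paths K s)" for i and f :: "_ \<Rightarrow> ennreal"
    unfolding measurable_cong_sets[OF sets refl]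
    by (intro measurable_compose[OF measurable_component_singleton]) auto
  then show ?thesis
    unfolding expected_time_def first_time_eq_suminf nn_integral_markov_paths_prefix[symmetric]
    by (intro nn_integral_suminf borel_measurable_times_ennreal borel_measurable_prod_ennreal)
qed

lemma expected_time_target: "s \<in> A \<Longrightarrow> expected_time K A s = 0"
proof -
  assume "s \<in> A"
  then have "(killed_step K A ^^ n) (indicator (- A)) s = 0" for n
    by (cases n) (auto simp: killed_step_def)
  then show ?thesis
    by (simp add: expected_time_eq_suminf)
qed

text \<open>First-step analysis, obtained by shifting the tail series; no finiteness is
  presupposed.\<close>

lemma expected_time_step:
  assumes "s \<notin> A"
  shows "expected_time K A s = 1 + (\<integral>\<^sup>+ t. expected_time K A t \<partial>K s)"
proof -
  let ?f = "\<lambda>n. (killed_step K A ^^ n) (indicator (- A))"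
  have "expected_time K A s = ?f 0 s + (\<Sum>n. ?f (Suc n) s)"
    unfolding expected_time_eq_suminf
    using suminf_offset[of "\<lambda>n. ?f n s" 1] by (simp add: add.commute)
  also have "(\<Sum>n. ?f (Suc n) s) = (\<Sum>n. \<integral>\<^sup>+ t. ?f n t \<partial>K s)"
    using assms by (simp add: killed_step_def)
  also have "\<dots> = (\<integral>\<^sup>+ t. expected_time K A t \<partial>K s)"
    unfolding expected_time_eq_suminf by (rule nn_integral_suminf[symmetric]) simp
  finally show ?thesis
    using assms by simp
qed

section \<open>Comparison with supersolutions and subsolutions\<close>

text \<open>Every step costs one, so by induction on the horizon \<open>V\<close> dominates each
  partial sum of the tail series. \<open>S\<close> is a set that the chain cannot leave before it
  meets \<open>A\<close>.\<close>

lemma expected_time_le_supersolution: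
  assumes closed: "\<And>s. s \<in> S \<Longrightarrow> s \<notin> A \<Longrightarrow> set_pmf (K s) \<subseteq> S"
    and super: "\<And>s. s \<in> S \<Longrightarrow> s \<notin> A \<Longrightarrow> 1 + (\<integral>\<^sup>+ t. V t \<partial>K s) \<le> V s"
    and "s \<in> S"
  shows "expected_time K A s \<le> V s"
proof -
  let ?f = "\<lambda>n. (killed_step K A ^^ n) (indicator (- A))"
  have "(\<Sum>n<N. ?f n s) \<le> V s" if "s \<in> S" for N s
    using that
  proof (induction N arbitrary: s)
    case (Suc N)
    show ?case
    proof (cases "s \<in> A")
      case True
      then have "?f n s = 0" for n
        by (cases n) (auto simp: killed_step_def)
      then show ?thesis
        by simp
    next
      case False
      have "(\<Sum>n<Suc N. ?f n s) = 1 + (\<integral>\<^sup>+ t. (\<Sum>n<N. ?f n t) \<partial>K s)"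
        using False unfolding sum.lessThan_Suc_shift
        by (simp add: killed_step_def nn_integral_sum)
      also have "\<dots> \<le> 1 + (\<integral>\<^sup>+ t. V t \<partial>K s)"
        using closed[OF Suc.prems False] Suc.IH
        by (intro add_left_mono nn_integral_mono_AE) (auto simp: AE_measure_pmf_iff)
      also have "\<dots> \<le> V s"
        by (rule super[OF Suc.prems False])
      finally show ?thesis .
    qed
  qed simp
  with \<open>s \<in> S\<close> show ?thesis
    unfolding expected_time_eq_suminf suminf_eq_SUP by (auto intro: SUP_least)
qed

text \<open>Unfolding \<open>V\<close> over \<open>N\<close> steps leaves an error of at most
  \<open>c\<close> times the probability of avoiding \<open>A\<close> up to time \<open>N\<close>.
  If the expected time is finite, this probability is a term of a convergent series and tends to
  0.\<close>

lemma subsolution_le_expected_time: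
  assumes closed: "\<And>s. s \<in> S \<Longrightarrow> s \<notin> A \<Longrightarrow> set_pmf (K s) \<subseteq> S"
    and sub: "\<And>s. s \<in> S \<Longrightarrow> s \<notin> A \<Longrightarrow> V s \<le> 1 + (\<integral>\<^sup>+ t. V t \<partial>K s)"
    and bound: "\<And>s. s \<in> S \<Longrightarrow> V s \<le> c * indicator (- A) s"
    and "c < \<infinity>" "s \<in> S"
  shows "V s \<le> expected_time K A s"
proof (cases "expected_time K A s = \<infinity>")
  case False
  let ?f = "\<lambda>n. (killed_step K A ^^ n) (indicator (- A))"
  have *: "V s \<le> (\<Sum>n<N. ?f n s) + c * ?f N s" if "s \<in> S" for N s
    using that
  proof (induction N arbitrary: s)
    case 0
    then show ?case
      using bound by simp
  next
    case (Suc N)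
    show ?case
    proof (cases "s \<in> A")
      case True
      then show ?thesis
        using bound[OF Suc.prems] by simp
    next
      case False
      have "V s \<le> 1 + (\<integral>\<^sup>+ t. V t \<partial>K s)"
        by (rule sub[OF Suc.prems False])
      also have "\<dots> \<le> 1 + (\<integral>\<^sup>+ t. (\<Sum>n<N. ?f n t) + c * ?f N t \<partial>K s)"
        using closed[OF Suc.prems False] Suc.IH
        by (intro add_left_mono nn_integral_mono_AE) (auto simp: AE_measure_pmf_iff)
      also have "\<dots> = (\<Sum>n<Suc N. ?f n s) + c * ?f (Suc N) s"
        using False unfolding sum.lessThan_Suc_shift
        by (simp add: killed_step_def nn_integral_sum nn_integral_add nn_integral_cmult add.assoc)
      finally show ?thesis .
    qed
  qed
  have fin: "?f n s < \<infinity>" for n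
  proof -
    have "?f n s \<le> (\<Sum>n. ?f n s)"
      using sum_le_suminf[of "\<lambda>n. ?f n s" "{n}"] by simp
    then show ?thesis
      using False unfolding expected_time_eq_suminf by (auto simp: less_top top_unique)
  qed
  then have real: "(\<lambda>n. ennreal (enn2real (?f n s))) = (\<lambda>n. ?f n s)"
    by auto
  then have "summable (\<lambda>n. enn2real (?f n s))"
    using False unfolding expected_time_eq_suminf by (intro summable_suminf_not_top) auto
  then have "(\<lambda>n. ennreal (enn2real (?f n s))) \<longlonglongrightarrow> ennreal 0"
    by (intro tendsto_ennrealI summable_LIMSEQ_zero)
  then have "(\<lambda>n. ?f n s) \<longlonglongrightarrow> 0"
    unfolding real by simp
  then have "(\<lambda>N. c * ?f N s) \<longlonglongrightarrow> c * 0"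
    using \<open>c < \<infinity>\<close> by (intro ennreal_tendsto_cmult) auto
  moreover have "(\<lambda>N. \<Sum>n<N. ?f n s) \<longlonglongrightarrow> expected_time K A s"
    unfolding expected_time_eq_suminf by (intro summable_LIMSEQ) simp
  ultimately have "(\<lambda>N. (\<Sum>n<N. ?f n s) + c * ?f N s) \<longlonglongrightarrow> expected_time K A s + c * 0"
    by (intro tendsto_add)
  then have "(\<lambda>N. (\<Sum>n<N. ?f n s) + c * ?f N s) \<longlonglongrightarrow> expected_time K A s"
    by simp
  then show ?thesis
    by (rule LIMSEQ_le_const) (use * \<open>s \<in> S\<close> in blast)
qed simp

section \<open>Hitting times of the simple random walk\<close>

text \<open>Connectedness together with a second vertex gives every vertex a neighbour, so the
  uniform step is well defined.\<close>

locale connected_graph = graph G for G :: "('a, 'b) pre_digraph" +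
  assumes connected: "Digraph_Component.connected G"
    and nontrivial: "card (verts G) \<ge> 2"
begin

definition nbhd :: "'a \<Rightarrow> 'a set" where
  "nbhd v = {w. v \<rightarrow>\<^bsub>G\<^esub> w}"

lemma in_nbhd_iff: "w \<in> nbhd v \<longleftrightarrow> v \<rightarrow>\<^bsub>G\<^esub> w"
  by (simp add: nbhd_def)

lemma srw_step_eq: "srw_step G v = pmf_of_set (nbhd v)"
  by (simp add: srw_step_def nbhd_def)

lemma nbhd_subset_verts: "nbhd v \<subseteq> verts G"
  by (auto simp: in_nbhd_iff intro: adj_in_verts)

lemma finite_nbhd [simp]: "finite (nbhd v)"
  by (rule finite_subset[OF nbhd_subset_verts finite_verts])

lemma reachable_verts: "x \<in> verts G \<Longrightarrow> y \<in> verts G \<Longrightarrow> x \<rightarrow>\<^sup>*\<^bsub>G\<^esub> y"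
  using symmetric_connected_imp_strongly_connected[OF sym_arcs connected]
  by (auto simp: strongly_connected_def)

lemma nbhd_nonempty: "v \<in> verts G \<Longrightarrow> nbhd v \<noteq> {}"
proof -
  assume v: "v \<in> verts G"
  obtain w where w: "w \<in> verts G" "w \<noteq> v"
    using nontrivial card_mono[of "{v}" "verts G"] by fastforce
  show ?thesis
    using reachable_verts[OF v w(1)] w(2) by (cases rule: converse_reachable_cases) (auto simp: nbhd_def)
qed

lemma card_nbhd_pos: "v \<in> verts G \<Longrightarrow> card (nbhd v) > 0"
  by (simp add: card_gt_0_iff nbhd_nonempty)

lemma not_adj_self: "\<not> v \<rightarrow>\<^bsub>G\<^esub> v"
  using no_loops by (auto simp: arcs_ends_conv)

lemma adj_sym: "v \<rightarrow>\<^bsub>G\<^esub> w \<longleftrightarrow> w \<rightarrow>\<^bsub>G\<^esub> v"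
  using sym_arcs unfolding symmetric_def by (meson symE)

lemma set_srw_step: "v \<in> verts G \<Longrightarrow> set_pmf (srw_step G v) = nbhd v"
  by (simp add: srw_step_eq set_pmf_of_set nbhd_nonempty)

lemma nn_integral_srw_step:
  assumes "v \<in> verts G" and "\<And>w. w \<in> nbhd v \<Longrightarrow> f w \<ge> 0"
  shows "(\<integral>\<^sup>+ w. ennreal (f w) \<partial>srw_step G v) = ennreal ((\<Sum>w\<in>nbhd v. f w) / card (nbhd v))"
proof -
  have "(\<integral>\<^sup>+ w. ennreal (f w) \<partial>srw_step G v) = (\<Sum>w\<in>nbhd v. ennreal (f w)) / card (nbhd v)"
    unfolding srw_step_eq
    by (rule nn_integral_pmf_of_set) (simp_all add: nbhd_nonempty assms(1))
  also have "\<dots> = ennreal ((\<Sum>w\<in>nbhd v. f w) / card (nbhd v))"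
    using assms card_nbhd_pos[OF assms(1)]
    by (simp add: sum_nonneg divide_ennreal[symmetric] ennreal_of_nat_eq_real_of_nat)
  finally show ?thesis .
qed

lemma hitting_time_eq_expected_time: "hitting_time G x y = expected_time (srw_step G) {y} x"
  by (simp add: hitting_time_def expected_time_def)

lemma hitting_time_le_supersolution:
  fixes f :: "'a \<Rightarrow> real"
  assumes nonneg: "\<And>v. v \<in> verts G \<Longrightarrow> f v \<ge> 0"
    and super: "\<And>v. v \<in> verts G \<Longrightarrow> v \<noteq> y \<Longrightarrow> 1 + (\<Sum>w\<in>nbhd v. f w) / card (nbhd v) \<le> f v"
    and "x \<in> verts G"
  shows "hitting_time G x y \<le> ennreal (f x)"
  unfolding hitting_time_eq_expected_time
proof (rule expected_time_le_supersolution[where S = "verts G"])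
  show "set_pmf (srw_step G v) \<subseteq> verts G" if "v \<in> verts G" for v
    using that nbhd_subset_verts by (simp add: set_srw_step)
  show "1 + (\<integral>\<^sup>+ w. ennreal (f w) \<partial>srw_step G v) \<le> ennreal (f v)"
    if "v \<in> verts G" "v \<notin> {y}" for v
  proof -
    have *: "f w \<ge> 0" if "w \<in> nbhd v" for w
      using that nonneg nbhd_subset_verts[of v] by blast
    have "ennreal (1 + (\<Sum>w\<in>nbhd v. f w) / card (nbhd v)) \<le> ennreal (f v)"
      using super that by (intro ennreal_leI) auto
    then show ?thesis
      using nn_integral_srw_step[of v f] that(1) *
      by (simp add: sum_nonneg)
  qed
qed fact

text \<open>With \<open>d v\<close> the distance to the target, \<open>N\<close> the largest distance and \<open>q\<close> at least twice
  every degree, \<open>q ^ (N + 1) - q ^ (N + 1 - d v)\<close> is a supersolution: the neighbour closer to the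
  target outweighs all the others.\<close>

lemma hitting_time_finite:
  assumes "x \<in> verts G" "y \<in> verts G"
  shows "hitting_time G x y < \<infinity>"
proof -
  define d where "d v = (LEAST n. (v, y) \<in> arcs_ends G ^^ n)" for v
  define N where "N = Max (d ` verts G)"
  define q :: real where "q = 2 * card (verts G)"
  have q: "q \<ge> 1"
    using nontrivial by (simp add: q_def)
  have d_le: "d v \<le> N" if "v \<in> verts G" for v
    unfolding N_def using that by (intro Max_ge) auto
  have d_rel: "(v, y) \<in> arcs_ends G ^^ d v" if "v \<in> verts G" for v
  proof -
    have "(v, y) \<in> (arcs_ends G)\<^sup>*"
      using reachable_verts[OF that assms(2)] by (rule reachable_rtranclI)
    then show ?thesis
      unfolding d_def by (auto dest!: rtrancl_imp_relpow intro: LeastI)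
  qed
  have closer: "\<exists>w\<in>nbhd v. d w < d v" if v: "v \<in> verts G" "v \<noteq> y" for v
  proof (cases "d v")
    case 0
    then show ?thesis
      using d_rel[OF v(1)] v(2) by simp
  next
    case (Suc m)
    then obtain w where "v \<rightarrow>\<^bsub>G\<^esub> w" "(w, y) \<in> arcs_ends G ^^ m"
      using d_rel[OF v(1)] by (metis relpow_Suc_D2)
    then show ?thesis
      using Suc by (intro bexI[of _ w]) (auto simp: in_nbhd_iff d_def less_Suc_eq_le intro: Least_le)
  qed
  define f where "f v = q ^ (N + 1) - q ^ (N + 1 - d v)" for v
  have f_nonneg: "f v \<ge> 0" for v
    using q by (simp add: f_def power_increasing del: power_Suc)
  have "1 + (\<Sum>w\<in>nbhd v. f w) / card (nbhd v) \<le> f v" if v: "v \<in> verts G" "v \<noteq> y" for v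
  proof -
    obtain w where w: "w \<in> nbhd v" "d w < d v"
      using closer[OF v] by blast
    let ?c = "real (card (nbhd v))" and ?r = "q ^ (N + 1 - d v)"
    have c: "?c > 0" "2 * ?c \<le> q"
      using card_nbhd_pos[OF v(1)] card_mono[OF finite_verts nbhd_subset_verts, of v] by (auto simp: q_def)
    have r: "?r \<ge> 1"
      using q by simp
    have "q * ?r = q ^ Suc (N + 1 - d v)"
      by simp
    also have "\<dots> \<le> q ^ (N + 1 - d w)"
      using q w d_le[OF v(1)] by (intro power_increasing) auto
    finally have fw: "f w \<le> q ^ (N + 1) - q * ?r"
      by (simp add: f_def)
    have "(\<Sum>w\<in>nbhd v. f w) = f w + (\<Sum>u\<in>nbhd v - {w}. f u)"
      using w by (intro sum.remove) auto
    also have "(\<Sum>u\<in>nbhd v - {w}. f u) \<le> (\<Sum>u\<in>nbhd v - {w}. q ^ (N + 1))"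
      using q by (intro sum_mono) (simp add: f_def)
    also have "\<dots> = (?c - 1) * q ^ (N + 1)"
      using w c by (simp add: card_Diff_singleton of_nat_diff Suc_leI del: power_Suc)
    finally have "(\<Sum>w\<in>nbhd v. f w) \<le> ?c * q ^ (N + 1) - q * ?r"
      using fw by (simp add: algebra_simps)
    also have "\<dots> \<le> ?c * q ^ (N + 1) - 2 * ?c * ?r"
      using c r by (simp add: mult_right_mono)
    \<comment> \<open>The factor two in \<open>q\<close> is spent here: one copy of
      \<open>?c * ?r\<close> stays for \<open>f v\<close>, the other is at least \<open>?c\<close>
      and pays the unit cost of the step.\<close>
    also have "\<dots> \<le> ?c * (q ^ (N + 1) - ?r - 1)"
      using mult_left_mono[OF r, of ?c] c by (simp add: algebra_simps)
    also have "\<dots> = ?c * (f v - 1)"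
      by (simp add: f_def)
    finally have "(\<Sum>w\<in>nbhd v. f w) / ?c \<le> f v - 1"
      using c by (simp add: pos_divide_le_eq mult.commute)
    then show ?thesis
      by simp
  qed
  then have "hitting_time G x y \<le> ennreal (f x)"
    using f_nonneg assms(1) by (intro hitting_time_le_supersolution) auto
  then show ?thesis
    by (simp add: le_less_trans)
qed

section \<open>One-step equation and triangle inequality\<close>

text \<open>Hitting times will be subtracted, hence the passage to reals; by
  \<open>hitting_time_finite\<close> nothing is lost on vertices.\<close>

definition H :: "'a \<Rightarrow> 'a \<Rightarrow> real" where
  "H x y = enn2real (hitting_time G x y)"

lemma hitting_time_eq_H: "x \<in> verts G \<Longrightarrow> y \<in> verts G \<Longrightarrow> hitting_time G x y = ennreal (H x y)"
  using hitting_time_finite by (simp add: H_def)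

lemma H_nonneg [simp]: "H x y \<ge> 0"
  by (simp add: H_def)

lemma H_self [simp]: "H y y = 0"
  by (simp add: H_def hitting_time_eq_expected_time expected_time_target)

lemma H_step:
  assumes "x \<in> verts G" "y \<in> verts G" "x \<noteq> y"
  shows "H x y = 1 + (\<Sum>w\<in>nbhd x. H w y) / card (nbhd x)"
proof -
  have "ennreal (H x y) = 1 + (\<integral>\<^sup>+ w. hitting_time G w y \<partial>srw_step G x)"
    using assms expected_time_step[of x "{y}" "srw_step G"]
    by (simp add: hitting_time_eq_H[symmetric] hitting_time_eq_expected_time)
  also have "(\<integral>\<^sup>+ w. hitting_time G w y \<partial>srw_step G x) = (\<integral>\<^sup>+ w. ennreal (H w y) \<partial>srw_step G x)"
    using assms nbhd_subset_verts[of x]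
    by (intro nn_integral_cong_AE) (auto simp: AE_measure_pmf_iff set_srw_step hitting_time_eq_H)
  also have "\<dots> = ennreal ((\<Sum>w\<in>nbhd x. H w y) / card (nbhd x))"
    using assms by (intro nn_integral_srw_step) auto
  also have "1 + \<dots> = ennreal (1 + (\<Sum>w\<in>nbhd x. H w y) / card (nbhd x))"
    by (simp add: sum_nonneg)
  finally show ?thesis
    by (simp add: sum_nonneg add_nonneg_nonneg del: ennreal_plus)
qed

lemma H_ge_1: "x \<in> verts G \<Longrightarrow> y \<in> verts G \<Longrightarrow> x \<noteq> y \<Longrightarrow> H x y \<ge> 1"
  by (simp add: H_step sum_nonneg)

text \<open>As functions of \<open>x\<close>, the two sides agree at \<open>v\<close>, so their minimum is a supersolution.\<close>

lemma H_triangle: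
  assumes "x \<in> verts G" "v \<in> verts G" "y \<in> verts G"
  shows "H x y \<le> H x v + H v y"
proof -
  define f where "f u = min (H u y) (H u v + H v y)" for u
  have "hitting_time G x y \<le> ennreal (f x)"
  proof (rule hitting_time_le_supersolution)
    show "1 + (\<Sum>w\<in>nbhd u. f w) / card (nbhd u) \<le> f u" if u: "u \<in> verts G" "u \<noteq> y" for u
    proof -
      have c: "real (card (nbhd u)) > 0"
        using card_nbhd_pos[OF u(1)] by simp
      have "1 + (\<Sum>w\<in>nbhd u. f w) / card (nbhd u) \<le> 1 + (\<Sum>w\<in>nbhd u. H w y) / card (nbhd u)"
        using c by (intro add_left_mono divide_right_mono sum_mono) (auto simp: f_def)
      then have le1: "1 + (\<Sum>w\<in>nbhd u. f w) / card (nbhd u) \<le> H u y"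
        using H_step[OF u(1) assms(3) u(2)] by simp
      moreover have "1 + (\<Sum>w\<in>nbhd u. f w) / card (nbhd u) \<le> H u v + H v y"
      proof (cases "u = v")
        case False
        have "1 + (\<Sum>w\<in>nbhd u. f w) / card (nbhd u)
            \<le> 1 + (\<Sum>w\<in>nbhd u. H w v + H v y) / card (nbhd u)"
          using c by (intro add_left_mono divide_right_mono sum_mono) (auto simp: f_def)
        also have "\<dots> = H u v + H v y"
          using H_step[OF u(1) assms(2) False] nbhd_nonempty[OF u(1)] by (simp add: sum.distrib add_divide_distrib)
        finally show ?thesis .
      qed (use le1 in simp)
      ultimately show ?thesis
        by (simp add: f_def)
    qed
  qed (auto simp: f_def assms)
  then have "ennreal (H x y) \<le> ennreal (f x)"
    by (simp add: hitting_time_eq_H assms)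
  then have "H x y \<le> f x"
    by (subst (asm) ennreal_le_iff) (auto simp: f_def)
  then show ?thesis
    by (simp add: f_def)
qed

section \<open>Reversibility and symmetrised hitting times\<close>

text \<open>The adjacency operator is self-adjoint because the arcs are symmetric. This is the form
  in which reversibility of the walk enters.\<close>

lemma sum_nbhd_swap:
  fixes f g :: "'a \<Rightarrow> real"
  shows "(\<Sum>v\<in>verts G. f v * (\<Sum>w\<in>nbhd v. g w)) = (\<Sum>v\<in>verts G. g v * (\<Sum>w\<in>nbhd v. f w))"
proof -
  have nb: "nbhd v = {w \<in> verts G. v \<rightarrow>\<^bsub>G\<^esub> w}" for v
    using nbhd_subset_verts by (auto simp: in_nbhd_iff)
  have "(\<Sum>v\<in>verts G. f v * (\<Sum>w\<in>nbhd v. g w))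
      = (\<Sum>v\<in>verts G. \<Sum>w | w \<in> verts G \<and> v \<rightarrow>\<^bsub>G\<^esub> w. f v * g w)"
    by (simp add: nb[symmetric] sum_distrib_left)
  also have "\<dots> = (\<Sum>w\<in>verts G. \<Sum>v | v \<in> verts G \<and> v \<rightarrow>\<^bsub>G\<^esub> w. f v * g w)"
    by (intro sum.swap_restrict) auto
  also have "\<dots> = (\<Sum>w\<in>verts G. g w * (\<Sum>v\<in>nbhd w. f v))"
    by (simp add: nb sum_distrib_left adj_sym mult.commute)
  finally show ?thesis .
qed

definition total_degree :: real where
  "total_degree = (\<Sum>v\<in>verts G. real (card (nbhd v)))"

lemma total_degree_pos: "total_degree > 0"
  unfolding total_degree_def using card_nbhd_pos nontrivial
  by (intro sum_pos) auto

text \<open>The case \<open>v = y\<close> says that the expected return time to \<open>y\<close> is the inverse of its stationary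
  probability; it follows by testing the other cases against constants.\<close>

lemma sum_nbhd_H:
  assumes "v \<in> verts G" "y \<in> verts G"
  shows "(\<Sum>w\<in>nbhd v. H w y)
    = card (nbhd v) * H v y - card (nbhd v) + (if v = y then total_degree else 0)"
proof -
  have off: "(\<Sum>w\<in>nbhd v. H w y) = card (nbhd v) * H v y - card (nbhd v)"
    if "v \<in> verts G" "v \<noteq> y" for v
    using H_step[OF that(1) assms(2) that(2)] card_nbhd_pos[OF that(1)] by (simp add: field_simps)
  have "(\<Sum>v\<in>verts G. \<Sum>w\<in>nbhd v. H w y) = (\<Sum>v\<in>verts G. card (nbhd v) * H v y)"
    using sum_nbhd_swap[of "\<lambda>_. 1" "\<lambda>v. H v y"] by (simp add: mult.commute)
  then have "(\<Sum>w\<in>nbhd y. H w y) + (\<Sum>v\<in>verts G - {y}. card (nbhd v) * H v y - card (nbhd v))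
      = (\<Sum>v\<in>verts G - {y}. card (nbhd v) * H v y)"
    using assms(2) off by (simp add: sum.remove[of "verts G" y])
  moreover have "total_degree = card (nbhd y) + (\<Sum>v\<in>verts G - {y}. real (card (nbhd v)))"
    unfolding total_degree_def using assms(2) by (simp add: sum.remove[of "verts G" y])
  ultimately have "(\<Sum>w\<in>nbhd y. H w y) = total_degree - card (nbhd y)"
    by (simp add: sum_subtractf)
  then show ?thesis
    using off assms by auto
qed

text \<open>The expected hitting time of \<open>y\<close> from the stationary law, which is
  proportional to the degree.\<close>

definition mean_hit :: "'a \<Rightarrow> real" where
  "mean_hit y = (\<Sum>v\<in>verts G. card (nbhd v) * H v y) / total_degree"

text \<open>Self-adjointness of the Laplacian: pair the Laplacian of \<open>H(\<cdot>, y)\<close> with \<open>H(\<cdot>, x)\<close>.\<close>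

lemma H_minus_mean_hit_sym:
  assumes "x \<in> verts G" "y \<in> verts G"
  shows "H x y - mean_hit y = H y x - mean_hit x"
proof -
  have *: "(\<Sum>v\<in>verts G. H v x * (\<Sum>w\<in>nbhd v. H w y))
      = (\<Sum>v\<in>verts G. card (nbhd v) * H v x * H v y) - total_degree * mean_hit x + total_degree * H y x"
    if "x \<in> verts G" "y \<in> verts G" for x y
  proof -
    have "(\<Sum>v\<in>verts G. H v x * (\<Sum>w\<in>nbhd v. H w y))
      = (\<Sum>v\<in>verts G. card (nbhd v) * H v x * H v y - card (nbhd v) * H v x
          + (if v = y then total_degree * H y x else 0))"
      using that by (intro sum.cong) (auto simp: sum_nbhd_H algebra_simps)
    then show ?thesis
      using that total_degree_pos by (simp add: sum.distrib sum_subtractf mean_hit_def)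
  qed
  \<comment> \<open>The left side of \<open>*\<close> is symmetric in \<open>x\<close> and
    \<open>y\<close> by \<open>sum_nbhd_swap\<close>, and so is the first sum on its right; only the
    boundary terms remain.\<close>
  have "total_degree * H y x - total_degree * mean_hit x = total_degree * H x y - total_degree * mean_hit y"
    using *[OF assms] *[OF assms(2,1)] sum_nbhd_swap[of "\<lambda>v. H v x" "\<lambda>v. H v y"]
    by (simp add: mult.commute mult.left_commute)
  then have "total_degree * (H y x - mean_hit x) = total_degree * (H x y - mean_hit y)"
    by (simp add: algebra_simps)
  then show ?thesis
    using total_degree_pos by simp
qed

section \<open>The worst-case hitting time\<close>

definition hmax :: real where
  "hmax = (MAX (x, y)\<in>verts G \<times> verts G. H x y)"

lemma H_le_hmax: "x \<in> verts G \<Longrightarrow> y \<in> verts G \<Longrightarrow> H x y \<le> hmax"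
  unfolding hmax_def by (intro Max_ge) force+

lemma hmax_ge_1: "hmax \<ge> 1"
proof -
  obtain x where x: "x \<in> verts G"
    using nontrivial by fastforce
  then obtain y where y: "x \<rightarrow>\<^bsub>G\<^esub> y"
    using nbhd_nonempty by (auto simp: nbhd_def)
  then have "y \<in> verts G" "x \<noteq> y"
    using not_adj_self by (auto intro: adj_in_verts)
  then show ?thesis
    using H_ge_1[of x y] H_le_hmax[of x y] x by simp
qed

lemma hmax_attained: obtains x y where "x \<in> verts G" "y \<in> verts G" "x \<noteq> y" "hmax = H x y"
proof -
  have "hmax \<in> (\<lambda>(x, y). H x y) ` (verts G \<times> verts G)"
    unfolding hmax_def using nontrivial by (intro Max_in) auto
  then obtain x y where xy: "x \<in> verts G" "y \<in> verts G" "hmax = H x y"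
    by auto
  moreover from xy have "x \<noteq> y"
    using hmax_ge_1 by auto
  ultimately show ?thesis
    using that by blast
qed

lemma max_hitting_time_eq_hmax: "max_hitting_time G = ennreal hmax"
proof (rule antisym)
  show "max_hitting_time G \<le> ennreal hmax"
    unfolding max_hitting_time_def by (intro SUP_least) (simp add: hitting_time_eq_H H_le_hmax ennreal_leI)
  show "ennreal hmax \<le> max_hitting_time G"
    by (rule hmax_attained)
      (auto simp: max_hitting_time_def simp flip: hitting_time_eq_H intro: SUP_upper2)
qed

section \<open>The symmetric potential\<close>

text \<open>\<open>H x y - mean_hit y\<close> is already symmetric. Adding the maximum makes the
  correction nonnegative, so the potential dominates \<open>H\<close> and inherits its triangle
  inequality.\<close>

definition potential :: "'a \<Rightarrow> 'a \<Rightarrow> real" where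
  "potential x y = H x y + (Max (mean_hit ` verts G) - mean_hit y)"

lemma potential_sym: "x \<in> verts G \<Longrightarrow> y \<in> verts G \<Longrightarrow> potential x y = potential y x"
  using H_minus_mean_hit_sym[of x y] by (simp add: potential_def)

lemma H_le_potential: "y \<in> verts G \<Longrightarrow> H x y \<le> potential x y"
  by (simp add: potential_def)

text \<open>If the maximum is attained at \<open>z\<close>, symmetry turns the correction into
  \<open>H y z - H z y\<close>. For distinct points this is at most \<open>hmax - 1\<close>, as a
  hitting time of another vertex is at least one.\<close>

lemma potential_le:
  assumes "x \<in> verts G" "y \<in> verts G"
  shows "potential x y \<le> 2 * hmax - 1"
proof -
  have "Max (mean_hit ` verts G) \<in> mean_hit ` verts G"
    using assms by (intro Max_in) auto
  then obtain z where z: "z \<in> verts G" "Max (mean_hit ` verts G) = mean_hit z"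
    by auto
  have "mean_hit z - mean_hit y \<le> hmax - 1"
  proof (cases "z = y")
    case False
    then show ?thesis
      using H_minus_mean_hit_sym[of z y] H_ge_1[of z y] H_le_hmax[of y z] z assms by simp
  qed (use hmax_ge_1 in simp)
  then show ?thesis
    using H_le_hmax[OF assms] z by (simp add: potential_def)
qed

lemma potential_triangle:
  assumes "x \<in> verts G" "v \<in> verts G" "y \<in> verts G"
  shows "potential x y \<le> potential x v + potential v y"
  using H_triangle[OF assms] H_le_potential[OF assms(2), of x] by (simp add: potential_def)

text \<open>The correction depends only on the fixed point \<open>y\<close>, so it passes through
  the average over neighbours of \<open>x\<close>.\<close>

lemma potential_step:
  assumes "x \<in> verts G" "y \<in> verts G" "x \<noteq> y"
  shows "1 + (\<Sum>w\<in>nbhd x. potential w y) / card (nbhd x) = potential x y"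
  using H_step[OF assms] nbhd_nonempty[OF assms(1)]
  by (simp add: potential_def sum.distrib add_divide_distrib)

end

section \<open>Two-type annihilation\<close>

text \<open>An average drop by one may be checked conditionally on each outcome of a preliminary
  choice, here the colour or the particle.\<close>

lemma nn_integral_pmf_add_1_le:
  assumes "\<And>x. x \<in> set_pmf M \<Longrightarrow> 1 + f x \<le> c"
  shows "1 + (\<integral>\<^sup>+ x. f x \<partial>measure_pmf M) \<le> c"
proof -
  have "1 + (\<integral>\<^sup>+ x. f x \<partial>measure_pmf M) = (\<integral>\<^sup>+ x. 1 + f x \<partial>measure_pmf M)"
    by (simp add: nn_integral_add)
  also have "\<dots> \<le> (\<integral>\<^sup>+ x. c \<partial>measure_pmf M)"
    using assms by (intro nn_integral_mono_AE) (auto simp: AE_measure_pmf_iff)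
  finally show ?thesis
    by simp
qed

lemma nn_integral_pmf_add_1_ge:
  assumes "\<And>x. x \<in> set_pmf M \<Longrightarrow> c \<le> 1 + f x"
  shows "c \<le> 1 + (\<integral>\<^sup>+ x. f x \<partial>measure_pmf M)"
proof -
  have "c = (\<integral>\<^sup>+ x. c \<partial>measure_pmf M)"
    by simp
  also have "\<dots> \<le> (\<integral>\<^sup>+ x. 1 + f x \<partial>measure_pmf M)"
    using assms by (intro nn_integral_mono_AE) (auto simp: AE_measure_pmf_iff)
  also have "\<dots> = 1 + (\<integral>\<^sup>+ x. f x \<partial>measure_pmf M)"
    by (simp add: nn_integral_add)
  finally show ?thesis .
qed

lemma nn_integral_move_particle:
  "(\<integral>\<^sup>+ s. f s \<partial>move_particle G A C) = (\<integral>\<^sup>+ x. \<integral>\<^sup>+ w.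
      f (if w \<in># C then (A - {#x#}, C - {#w#}) else (add_mset w (A - {#x#}), C))
    \<partial>srw_step G x \<partial>pmf_of_multiset A)"
  by (simp add: move_particle_def)

lemma set_pmf_move_particle:
  assumes "A \<noteq> {#}"
  shows "set_pmf (move_particle G A C) = (\<Union>x\<in>set_mset A. \<Union>w\<in>set_pmf (srw_step G x).
    {if w \<in># C then (A - {#x#}, C - {#w#}) else (add_mset w (A - {#x#}), C)})"
  using assms by (simp add: move_particle_def)

lemma annihilation_step_nonempty:
  "R \<noteq> {#} \<Longrightarrow> annihilation_step G p (R, B) = bernoulli_pmf p \<bind>
    (\<lambda>red. if red then move_particle G R B else map_pmf prod.swap (move_particle G B R))"
  by (simp add: annihilation_step_def)

section \<open>Costs of pairs\<close>

context connected_graph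
begin

text \<open>The shift by \<open>2 * hmax - 2\<close> is what makes the diagonal value both large enough to
  pay for a first step away from a shared vertex and small enough for the triangle inequality.\<close>

definition pair_cost :: "'a \<Rightarrow> 'a \<Rightarrow> real" where
  "pair_cost x y = (if x = y then 4 * hmax - 2 else potential x y + 2 * hmax - 2)"

lemma pair_cost_sym: "x \<in> verts G \<Longrightarrow> y \<in> verts G \<Longrightarrow> pair_cost x y = pair_cost y x"
  by (simp add: pair_cost_def potential_sym)

lemma pair_cost_le: "x \<in> verts G \<Longrightarrow> y \<in> verts G \<Longrightarrow> pair_cost x y \<le> 4 * hmax - 2"
  using potential_le[of x y] by (simp add: pair_cost_def)

lemma potential_ge_1: "x \<in> verts G \<Longrightarrow> y \<in> verts G \<Longrightarrow> x \<noteq> y \<Longrightarrow> potential x y \<ge> 1"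
  using H_le_potential[of y x] H_ge_1[of x y] by simp

lemma pair_cost_nonneg: "x \<in> verts G \<Longrightarrow> y \<in> verts G \<Longrightarrow> pair_cost x y \<ge> 0"
  using potential_ge_1[of x y] hmax_ge_1 by (cases "x = y") (auto simp: pair_cost_def)

text \<open>For \<open>x = y\<close> the two potentials are at least 1 each, and with two shifts of
  \<open>2 * hmax - 2\<close> they add up to at least the diagonal value. With all three points
  distinct, the second shift is a nonnegative surplus.\<close>

lemma pair_cost_triangle:
  assumes "x \<in> verts G" "v \<in> verts G" "y \<in> verts G" "v \<noteq> y"
  shows "pair_cost x y \<le> pair_cost x v + pair_cost v y"
proof -
  consider "x = v" | "x = y" "x \<noteq> v" | "x \<noteq> v" "x \<noteq> y"
    by blast
  then show ?thesis
  proof cases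
    case 1
    then show ?thesis
      using hmax_ge_1 by (simp add: pair_cost_def)
  next
    case 2
    then show ?thesis
      using assms potential_ge_1[of x v] potential_ge_1[of v y] by (simp add: pair_cost_def)
  next
    case 3
    then show ?thesis
      using assms potential_triangle[of x v y] hmax_ge_1 by (simp add: pair_cost_def)
  qed
qed

text \<open>Off the diagonal the potential itself drops by one. On the diagonal, the potential after
  the step is at most \<open>2 * hmax - 1\<close>, and the shift plus the unit cost complete this to
  \<open>4 * hmax - 2\<close>.\<close>

lemma pair_cost_step:
  assumes "x \<in> verts G" "y \<in> verts G"
  shows "1 + (\<Sum>w\<in>nbhd x. if w = y then 0 else pair_cost w y) / card (nbhd x) \<le> pair_cost x y"
proof -
  have c: "real (card (nbhd x)) > 0"
    using card_nbhd_pos[OF assms(1)] by simp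
  have pot_nonneg: "potential w y \<ge> 0" for w
    using H_le_potential[OF assms(2), of w] H_nonneg[of w y] by linarith
  \<comment> \<open>Raising the value 0 of an annihilated pair to potential plus shift makes all
    summands uniform.\<close>
  have "(\<Sum>w\<in>nbhd x. if w = y then 0 else pair_cost w y) / card (nbhd x)
      \<le> (\<Sum>w\<in>nbhd x. potential w y + (2 * hmax - 2)) / card (nbhd x)"
    using c pot_nonneg hmax_ge_1 by (intro divide_right_mono sum_mono) (auto simp: pair_cost_def)
  also have "\<dots> = (\<Sum>w\<in>nbhd x. potential w y) / card (nbhd x) + (2 * hmax - 2)"
    using nbhd_nonempty[OF assms(1)] by (simp add: sum.distrib add_divide_distrib)
  also have "1 + \<dots> \<le> pair_cost x y"
  proof (cases "x = y")
    case True
    have "(\<Sum>w\<in>nbhd x. potential w y) \<le> (\<Sum>w\<in>nbhd x. 2 * hmax - 1)"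
      using nbhd_subset_verts[of x] assms by (intro sum_mono potential_le) auto
    then have "(\<Sum>w\<in>nbhd x. potential w y) / card (nbhd x) \<le> 2 * hmax - 1"
      using c by (simp add: pos_divide_le_eq mult.commute)
    then show ?thesis
      using True by (simp add: pair_cost_def)
  next
    case False
    then show ?thesis
      using potential_step[OF assms False] by (simp add: pair_cost_def)
  qed
  finally show ?thesis
    by simp
qed

section \<open>Cheapest matchings as a supersolution\<close>

definition pairing_cost :: "('a \<times> 'a) multiset \<Rightarrow> ennreal" where
  "pairing_cost P = (\<Sum>(x, y)\<in>#P. ennreal (pair_cost x y))"

lemma pairing_cost_add_mset [simp]:
  "pairing_cost (add_mset (x, y) P) = ennreal (pair_cost x y) + pairing_cost P"
  by (simp add: pairing_cost_def)

text \<open>A matching is a multiset of pairs with prescribed marginals. If the two sizes differ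
  there is none, and the infimum is infinite.\<close>

fun matching_cost :: "'a multiset \<times> 'a multiset \<Rightarrow> ennreal" where
  "matching_cost (R, B) = (INF P\<in>{P. image_mset fst P = R \<and> image_mset snd P = B}. pairing_cost P)"

lemma matching_cost_le: "matching_cost (image_mset fst P, image_mset snd P) \<le> pairing_cost P"
  by (auto intro: INF_lower)

definition valid_states :: "('a multiset \<times> 'a multiset) set" where
  "valid_states = {(R, B). size R = size B \<and> set_mset R \<subseteq> verts G \<and> set_mset B \<subseteq> verts G}"

text \<open>Flipping all pairs preserves the cost, since \<open>pair_cost\<close> is symmetric on
  vertices. This reduces blue moves to red ones.\<close>

lemma matching_cost_swap_le:
  assumes "set_mset R \<subseteq> verts G" "set_mset B \<subseteq> verts G"
  shows "matching_cost (B, R) \<le> matching_cost (R, B)"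
  unfolding matching_cost.simps(1)[of R B]
proof (rule INF_greatest)
  fix P assume "P \<in> {P. image_mset fst P = R \<and> image_mset snd P = B}"
  then have P: "image_mset fst P = R" "image_mset snd P = B"
    by auto
  have mem: "x \<in> verts G \<and> y \<in> verts G" if "(x, y) \<in># P" for x y
    using that assms unfolding P[symmetric] by force
  have "matching_cost (B, R) \<le> pairing_cost (image_mset prod.swap P)"
    using matching_cost_le[of "image_mset prod.swap P"] P by (simp add: multiset.map_comp comp_def)
  also have "\<dots> = pairing_cost P"
    unfolding pairing_cost_def using mem
    by (auto simp: multiset.map_comp comp_def case_prod_unfold pair_cost_sym intro!: arg_cong[of _ _ sum_mset] image_mset_cong)
  finally show "matching_cost (B, R) \<le> pairing_cost P" .
qed

lemma matching_cost_swap: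
  assumes "s \<in> valid_states"
  shows "matching_cost (prod.swap s) = matching_cost s"
  using assms matching_cost_swap_le
  by (cases s) (auto simp: valid_states_def simp del: matching_cost.simps intro!: antisym)

text \<open>If the mover of a pair \<open>(x, b)\<close> annihilates with the partner of some other \<open>u\<close>, then
  \<open>u\<close> and \<open>b\<close> form a new pair, whose cost is controlled by the triangle inequality.\<close>

lemma matching_cost_after_move:
  assumes verts: "set_mset P \<subseteq> verts G \<times> verts G"
    and P: "P = add_mset (x, b) Q" and "w \<in> verts G"
    and R: "R = image_mset fst P" and B: "B = image_mset snd P"
  shows "matching_cost (if w \<in># B then (R - {#x#}, B - {#w#}) else (add_mset w (R - {#x#}), B))
    \<le> pairing_cost Q + ennreal (if w = b then 0 else pair_cost w b)"
proof -
  consider "w = b" | "w \<noteq> b" "w \<in># B" | "w \<notin># B"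
    by blast
  then show ?thesis
  proof cases
    case 1
    then show ?thesis
      using matching_cost_le[of Q] by (simp add: P R B del: matching_cost.simps)
  next
    case 2
    then have "w \<in># image_mset snd Q"
      by (simp add: B P)
    then obtain u where "(u, w) \<in># Q"
      by auto
    then obtain Q' where Q: "Q = add_mset (u, w) Q'"
      by (metis insert_DiffM)
    have u: "u \<in> verts G" "b \<in> verts G"
      using verts by (auto simp: P Q)
    have "B - {#w#} = add_mset b (image_mset snd Q')"
      by (simp add: B P Q)
    then have "matching_cost (R - {#x#}, B - {#w#}) \<le> pairing_cost (add_mset (u, b) Q')"
      using matching_cost_le[of "add_mset (u, b) Q'"] by (simp add: P Q R del: matching_cost.simps)
    also have "\<dots> \<le> ennreal (pair_cost u w + pair_cost w b) + pairing_cost Q'"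
      using pair_cost_triangle[OF u(1) \<open>w \<in> verts G\<close> u(2) 2(1)]
      by (simp add: ennreal_leI add_right_mono del: ennreal_plus)
    also have "\<dots> = pairing_cost Q + ennreal (pair_cost w b)"
      using pair_cost_nonneg u \<open>w \<in> verts G\<close> by (simp add: Q add_ac)
    finally show ?thesis
      using 2 by (simp del: matching_cost.simps)
  next
    case 3
    then have "w \<noteq> b"
      by (auto simp: B P)
    with 3 show ?thesis
      using matching_cost_le[of "add_mset (w, b) Q"] by (simp add: P R B add.commute del: matching_cost.simps)
  qed
qed

text \<open>The bound is proved against every matching \<open>P\<close>, so no optimal one has to be
  chosen. Given the mover, only its own pair \<open>(x, b)\<close> changes in expected cost;
  \<open>Q\<close> enters as a constant.\<close>

lemma matching_cost_move_particle:
  assumes "(R, B) \<in> valid_states" "R \<noteq> {#}"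
  shows "1 + (\<integral>\<^sup>+ s. matching_cost s \<partial>move_particle G R B) \<le> matching_cost (R, B)"
  unfolding matching_cost.simps(1)[of R B]
proof (rule INF_greatest)
  fix P assume "P \<in> {P. image_mset fst P = R \<and> image_mset snd P = B}"
  then have P: "R = image_mset fst P" "B = image_mset snd P"
    by auto
  have verts: "set_mset P \<subseteq> verts G \<times> verts G"
    using assms(1) unfolding P valid_states_def by force
  show "1 + (\<integral>\<^sup>+ s. matching_cost s \<partial>move_particle G R B) \<le> pairing_cost P"
    unfolding nn_integral_move_particle
  proof (rule nn_integral_pmf_add_1_le)
    fix x assume "x \<in> set_pmf (pmf_of_multiset R)"
    then have "x \<in># R"
      using assms(2) by simp
    \<comment> \<open>Particles on one vertex are interchangeable, so any pair with first entry
      \<open>x\<close> may be taken as that of the mover.\<close>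
    then obtain b where "(x, b) \<in># P"
      by (auto simp: P)
    then obtain Q where Q: "P = add_mset (x, b) Q"
      by (metis insert_DiffM)
    have xb: "x \<in> verts G" "b \<in> verts G"
      using verts by (auto simp: Q)
    let ?g = "\<lambda>w. if w = b then 0 else pair_cost w b"
    have nonneg: "?g w \<ge> 0" if "w \<in> nbhd x" for w
      using that nbhd_subset_verts[of x] pair_cost_nonneg xb by auto
    have "1 + (\<integral>\<^sup>+ w. matching_cost (if w \<in># B then (R - {#x#}, B - {#w#})
        else (add_mset w (R - {#x#}), B)) \<partial>srw_step G x)
      \<le> 1 + (\<integral>\<^sup>+ w. pairing_cost Q + ennreal (?g w) \<partial>srw_step G x)"
      using nbhd_subset_verts[of x]
      by (intro add_left_mono nn_integral_mono_AE)
        (auto simp only: AE_measure_pmf_iff set_srw_step[OF xb(1)]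
          intro!: matching_cost_after_move[OF verts Q _ P])
    also have "\<dots> = pairing_cost Q + ennreal (1 + (\<Sum>w\<in>nbhd x. ?g w) / card (nbhd x))"
      using nn_integral_srw_step[OF xb(1) nonneg] nonneg
      by (simp add: nn_integral_add sum_nonneg add_ac del: ennreal_0)
    also have "\<dots> \<le> pairing_cost Q + ennreal (pair_cost x b)"
      using pair_cost_step[OF xb] by (intro add_left_mono ennreal_leI)
    finally show "1 + (\<integral>\<^sup>+ w. matching_cost (if w \<in># B then (R - {#x#}, B - {#w#})
        else (add_mset w (R - {#x#}), B)) \<partial>srw_step G x) \<le> pairing_cost P"
      by (simp add: Q add.commute)
  qed
qed

section \<open>Invariance of the valid states and the upper bound\<close>

lemma move_particle_valid:
  assumes "(R, B) \<in> valid_states" "R \<noteq> {#}"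
  shows "set_pmf (move_particle G R B) \<subseteq> valid_states"
proof
  fix s assume "s \<in> set_pmf (move_particle G R B)"
  then obtain x w where x: "x \<in># R" and w: "w \<in> set_pmf (srw_step G x)"
    and s: "s = (if w \<in># B then (R - {#x#}, B - {#w#}) else (add_mset w (R - {#x#}), B))"
    unfolding set_pmf_move_particle[OF assms(2)] by blast
  have "x \<in> verts G"
    using x assms(1) by (auto simp: valid_states_def)
  then have "w \<in> verts G"
    using w nbhd_subset_verts[of x] by (auto simp: set_srw_step)
  moreover obtain R' where "R = add_mset x R'"
    using x by (metis insert_DiffM)
  ultimately show "s \<in> valid_states"
    using assms(1) by (auto simp: s valid_states_def size_Diff_singleton dest: in_diffD)
qed

lemma valid_states_swap: "s \<in> valid_states \<Longrightarrow> prod.swap s \<in> valid_states"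
  by (auto simp: valid_states_def)

lemma valid_nonempty:
  "(R, B) \<in> valid_states \<Longrightarrow> (R, B) \<noteq> ({#}, {#}) \<Longrightarrow> R \<noteq> {#} \<and> B \<noteq> {#}"
  by (auto simp: valid_states_def)

lemma annihilation_step_valid:
  assumes "s \<in> valid_states" "s \<noteq> ({#}, {#})"
  shows "set_pmf (annihilation_step G p s) \<subseteq> valid_states"
proof
  fix t assume t: "t \<in> set_pmf (annihilation_step G p s)"
  obtain R B where s: "s = (R, B)"
    by (cases s)
  have valid: "(R, B) \<in> valid_states" "(B, R) \<in> valid_states"
    using assms(1) valid_states_swap[of s] by (simp_all add: s)
  have ne: "R \<noteq> {#}" "B \<noteq> {#}"
    using valid_nonempty[of R B] assms by (simp_all add: s)
  from t consider "t \<in> set_pmf (move_particle G R B)"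
    | u where "t = prod.swap u" "u \<in> set_pmf (move_particle G B R)"
    by (auto simp: s annihilation_step_nonempty[OF ne(1)] split: if_splits)
  then show "t \<in> valid_states"
    using move_particle_valid[OF valid(1) ne(1)] move_particle_valid[OF valid(2) ne(2)]
      valid_states_swap by cases blast+
qed

text \<open>The unit drop holds given either colour, hence for every \<open>p\<close>.\<close>

lemma matching_cost_annihilation_step:
  assumes "s \<in> valid_states" "s \<noteq> ({#}, {#})"
  shows "1 + (\<integral>\<^sup>+ t. matching_cost t \<partial>annihilation_step G p s) \<le> matching_cost s"
proof (cases s)
  case (Pair R B)
  have valid: "(R, B) \<in> valid_states" "(B, R) \<in> valid_states"
    using assms(1) valid_states_swap[of s] by (simp_all add: Pair)
  have ne: "R \<noteq> {#}" "B \<noteq> {#}"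
    using valid_nonempty[of R B] assms by (simp_all add: Pair)
  have red: "1 + (\<integral>\<^sup>+ t. matching_cost t \<partial>move_particle G R B) \<le> matching_cost s"
    unfolding Pair by (intro matching_cost_move_particle valid ne)
  have "(\<integral>\<^sup>+ t. matching_cost (prod.swap t) \<partial>move_particle G B R)
      = (\<integral>\<^sup>+ t. matching_cost t \<partial>move_particle G B R)"
    using move_particle_valid[OF valid(2) ne(2)]
    by (intro nn_integral_cong_AE) (auto simp only: AE_measure_pmf_iff matching_cost_swap)
  then have blue: "1 + (\<integral>\<^sup>+ t. matching_cost (prod.swap t) \<partial>move_particle G B R) \<le> matching_cost s"
    using matching_cost_move_particle[OF valid(2) ne(2)] matching_cost_swap[OF valid(1)]
    by (simp add: Pair del: matching_cost.simps)
  show ?thesis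
    unfolding Pair annihilation_step_nonempty[OF ne(1)] nn_integral_bind_pmf
  proof (rule nn_integral_pmf_add_1_le)
    fix r :: bool
    show "1 + (\<integral>\<^sup>+ t. matching_cost t \<partial>(if r then move_particle G R B
        else map_pmf prod.swap (move_particle G B R))) \<le> matching_cost (R, B)"
      using red blue by (cases r) (simp_all add: Pair del: matching_cost.simps)
  qed
qed

lemma pairing_cost_le:
  "set_mset P \<subseteq> verts G \<times> verts G \<Longrightarrow> pairing_cost P \<le> of_nat (size P) * ennreal (4 * hmax - 2)"
proof (induction P)
  case (add xy P)
  then show ?case
    using add_mono[OF ennreal_leI[OF pair_cost_le] add.IH]
    by (cases xy) (simp add: distrib_right)
qed (simp add: pairing_cost_def)

text \<open>Zipping arbitrary enumerations of the two colours gives a matching, and any matching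
  bounds the infimum.\<close>

lemma matching_cost_le_size:
  assumes "(R, B) \<in> valid_states"
  shows "matching_cost (R, B) \<le> of_nat (size R) * ennreal (4 * hmax - 2)"
proof -
  obtain rs bs where lists: "mset rs = R" "mset bs = B"
    using ex_mset by metis
  let ?P = "mset (zip rs bs)"
  have len: "length rs = length bs"
    using assms lists by (auto simp: valid_states_def simp flip: size_mset)
  then have P: "image_mset fst ?P = R" "image_mset snd ?P = B" "size ?P = size R"
    using lists by (simp_all flip: mset_map) auto
  have "set_mset ?P \<subseteq> verts G \<times> verts G"
    using assms lists by (auto simp: valid_states_def elim!: in_set_zipE)
  then have "pairing_cost ?P \<le> of_nat (size R) * ennreal (4 * hmax - 2)"
    unfolding P(3)[symmetric] by (rule pairing_cost_le)
  with matching_cost_le[of ?P] show ?thesis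
    unfolding P(1,2) by (rule order_trans)
qed

lemma expected_extinction_time_le:
  assumes "(R, B) \<in> valid_states"
  shows "expected_extinction_time G p R B \<le> of_nat (size R) * ennreal (4 * hmax - 2)"
proof -
  have "expected_extinction_time G p R B = expected_time (annihilation_step G p) {({#}, {#})} (R, B)"
    by (simp add: expected_extinction_time_def expected_time_def)
  also have "\<dots> \<le> matching_cost (R, B)"
    using assms annihilation_step_valid matching_cost_annihilation_step
    by (intro expected_time_le_supersolution[where S = valid_states]) auto
  also have "\<dots> \<le> of_nat (size R) * ennreal (4 * hmax - 2)"
    by (rule matching_cost_le_size[OF assms])
  finally show ?thesis .
qed

section \<open>The lower bound\<close>

definition total_hit :: "'a \<Rightarrow> 'a multiset \<Rightarrow> ennreal" where
  "total_hit y R = (\<Sum>r\<in>#R. ennreal (H r y))"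

lemma total_hit_add_mset [simp]: "total_hit y (add_mset x R) = ennreal (H x y) + total_hit y R"
  by (simp add: total_hit_def)

lemma total_hit_le:
  "y \<in> verts G \<Longrightarrow> set_mset R \<subseteq> verts G \<Longrightarrow> total_hit y R \<le> of_nat (size R) * ennreal hmax"
proof (induction R)
  case (add x R)
  then show ?case
    using add_mono[OF ennreal_leI[OF H_le_hmax[of x y]] add.IH] by (simp add: distrib_right)
qed (simp add: total_hit_def)

text \<open>At speed 1 the blue particles stay at \<open>y\<close>, and a red one is removed exactly
  when it first gets there. Each move thus lowers the total hitting time by one on average, which
  makes it a bounded subsolution.\<close>

lemma total_hit_le_expected_extinction_time:
  assumes y: "y \<in> verts G" and "set_mset R \<subseteq> verts G" "y \<notin># R"
  shows "total_hit y R \<le> expected_extinction_time G 1 R (replicate_mset (size R) y)"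
proof -
  define S where "S = {(R', replicate_mset (size R') y) | R'.
    set_mset R' \<subseteq> verts G \<and> y \<notin># R' \<and> size R' \<le> size R}"
  have step: "annihilation_step G 1 (R', B) = move_particle G R' B" if "R' \<noteq> {#}" for R' B
  proof -
    have "bernoulli_pmf 1 = return_pmf True"
      by (rule pmf_eqI) (simp split: split_indicator)
    then show ?thesis
      using that by (simp add: annihilation_step_nonempty bind_return_pmf)
  qed
  have "(total_hit y \<circ> fst) (R, replicate_mset (size R) y)
      \<le> expected_time (annihilation_step G 1) {({#}, {#})} (R, replicate_mset (size R) y)"
  proof (rule subsolution_le_expected_time[where S = S and c = "of_nat (size R) * ennreal hmax"])
    fix s assume "s \<in> S" and s_ne: "s \<notin> {({#}, {#})}"
    then obtain R' where s: "s = (R', replicate_mset (size R') y)"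
      and R': "set_mset R' \<subseteq> verts G" "y \<notin># R'" "size R' \<le> size R"
      by (auto simp: S_def)
    then have ne: "R' \<noteq> {#}"
      using s_ne by auto
    show "set_pmf (annihilation_step G 1 s) \<subseteq> S"
    proof
      fix t assume "t \<in> set_pmf (annihilation_step G 1 s)"
      then obtain x w where x: "x \<in># R'" and w: "w \<in> set_pmf (srw_step G x)"
        and t: "t = (if w \<in># replicate_mset (size R') y
            then (R' - {#x#}, replicate_mset (size R') y - {#w#})
            else (add_mset w (R' - {#x#}), replicate_mset (size R') y))"
        unfolding s step[OF ne] set_pmf_move_particle[OF ne] by blast
      obtain R'' where R'': "R' = add_mset x R''"
        using x by (metis insert_DiffM)
      have "x \<in> verts G"
        using x R' by auto
      then have "w \<in> verts G"
        using w nbhd_subset_verts[of x] by (auto simp: set_srw_step)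
      show "t \<in> S"
      proof (cases "w = y")
        case True
        then have "t = (R'', replicate_mset (size R'') y)"
          by (simp add: t R'')
        then show ?thesis
          using R' by (simp add: S_def R'')
      next
        case False
        then have "t = (add_mset w R'', replicate_mset (size (add_mset w R'')) y)"
          by (simp add: t R'')
        then show ?thesis
          using R' False \<open>w \<in> verts G\<close> by (simp add: S_def R'')
      qed
    qed
    show "(total_hit y \<circ> fst) s \<le> 1 + (\<integral>\<^sup>+ t. (total_hit y \<circ> fst) t \<partial>annihilation_step G 1 s)"
      unfolding s step[OF ne] nn_integral_move_particle
    proof (rule nn_integral_pmf_add_1_ge)
      fix x assume "x \<in> set_pmf (pmf_of_multiset R')"
      then have x: "x \<in># R'"
        using ne by simp
      then obtain R'' where R'': "R' = add_mset x R''"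
        by (metis insert_DiffM)
      have xv: "x \<in> verts G" "x \<noteq> y"
        using x R' by auto
      \<comment> \<open>Annihilation needs no separate formula: it happens exactly for
        \<open>w = y\<close>, where \<open>H w y\<close> is 0.\<close>
      have "(total_hit y \<circ> fst) (if w \<in># replicate_mset (size R') y
            then (R' - {#x#}, replicate_mset (size R') y - {#w#})
            else (add_mset w (R' - {#x#}), replicate_mset (size R') y))
          = ennreal (H w y) + total_hit y R''" for w
        by (auto simp: R'')
      then show "(total_hit y \<circ> fst) (R', replicate_mset (size R') y) \<le> 1 + (\<integral>\<^sup>+ w.
          (total_hit y \<circ> fst) (if w \<in># replicate_mset (size R') y
            then (R' - {#x#}, replicate_mset (size R') y - {#w#})
            else (add_mset w (R' - {#x#}), replicate_mset (size R') y)) \<partial>srw_step G x)"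
        using H_step[OF xv(1) y xv(2)] nn_integral_srw_step[OF xv(1), of "\<lambda>w. H w y"]
        by (simp add: R'' nn_integral_add sum_nonneg add_ac)
    qed
  next
    fix s assume "s \<in> S"
    then obtain R' where s: "s = (R', replicate_mset (size R') y)"
      and R': "set_mset R' \<subseteq> verts G" "size R' \<le> size R"
      by (auto simp: S_def)
    show "(total_hit y \<circ> fst) s \<le> of_nat (size R) * ennreal hmax * indicator (- {({#}, {#})}) s"
    proof (cases "R' = {#}")
      case False
      have "total_hit y R' \<le> of_nat (size R') * ennreal hmax"
        by (rule total_hit_le[OF y R'(1)])
      also have "\<dots> \<le> of_nat (size R) * ennreal hmax"
        using R'(2) by (intro mult_right_mono) auto
      finally show ?thesis
        using False by (simp add: s)
    qed (simp add: s total_hit_def)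
  next
    show "(R, replicate_mset (size R) y) \<in> S"
      using assms by (auto simp: S_def)
  qed (simp add: ennreal_mult_less_top ennreal_of_nat_eq_real_of_nat)
  then show ?thesis
    by (simp add: expected_extinction_time_def expected_time_def)
qed

end

theorem proposition1p3:
  fixes G :: "('a, 'b) pre_digraph" and k :: nat
  assumes "graph G" and "Digraph_Component.connected G" and "card (verts G) \<ge> 2" and "k \<ge> 1"
  shows "of_nat k * max_hitting_time G \<le> worst_extinction_time G k
    \<and> worst_extinction_time G k < 4 * of_nat k * max_hitting_time G"
proof
  interpret connected_graph G
    using assms by (simp add: connected_graph_def connected_graph_axioms_def)
  obtain x y where xy: "x \<in> verts G" "y \<in> verts G" "x \<noteq> y" "hmax = H x y"
    by (rule hmax_attained)
  have total: "total_hit y (replicate_mset k x) = of_nat k * ennreal (H x y)" for k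
    by (induction k) (simp_all add: total_hit_def distrib_right)
  have "of_nat k * max_hitting_time G = total_hit y (replicate_mset k x)"
    by (simp add: total max_hitting_time_eq_hmax xy)
  also have "\<dots> \<le> expected_extinction_time G 1 (replicate_mset k x) (replicate_mset k y)"
    using total_hit_le_expected_extinction_time[of y "replicate_mset k x"] xy by auto
  also have "\<dots> \<le> worst_extinction_time G k"
    unfolding worst_extinction_time_def
    by (rule SUP_upper2[of "(1, replicate_mset k x, replicate_mset k y)"]) (use xy in auto)
  finally show "of_nat k * max_hitting_time G \<le> worst_extinction_time G k" .
  have "worst_extinction_time G k \<le> of_nat k * ennreal (4 * hmax - 2)"
    unfolding worst_extinction_time_def
    by (intro SUP_least) (auto simp: valid_states_def intro!: order_trans[OF expected_extinction_time_le])
  also have "\<dots> = ennreal (k * (4 * hmax - 2))"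
    using hmax_ge_1 by (simp add: ennreal_mult ennreal_of_nat_eq_real_of_nat)
  \<comment> \<open>The slack \<open>2 * k\<close> is uniform over speeds and starting positions, so
    strictness survives the supremum.\<close>
  also have "\<dots> < ennreal (4 * k * hmax)"
    using hmax_ge_1 assms(4) by (intro ennreal_lessI) auto
  also have "\<dots> = 4 * of_nat k * max_hitting_time G"
    using hmax_ge_1 by (simp add: max_hitting_time_eq_hmax ennreal_mult ennreal_of_nat_eq_real_of_nat)
  finally show "worst_extinction_time G k < 4 * of_nat k * max_hitting_time G" .
qed

end
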